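(* Let $T$ be a tree with vertex set $\{1,\ldots,n\}$ and nonzero real edge weights, with no vertex of degree $2$. Let $\beta=\hat\delta'\hat\tau\hat\delta$ and $\eta=2\tau-L\hat\tau\hat\delta$. If $\beta\neq0$, then the squared distance matrix $\Delta$ of $T$ is nonsingular and $$\Delta^{-1}=-\frac14 L\hat\tau L+\frac{1}{4\beta}\eta\eta'.$$
   Context: For vertices $i\neq j$, $d(i,j)$ is the sum of the weights of the edges on the unique $ij$-path, $d(i,i)=0$, and $\Delta$ is the $n\times n$ matrix with $(i,j)$-entry $d(i,j)^2$. $L$ is the weighted Laplacian: for $i\neq j$ its $(i,j)$-entry is $-1/w$ if $i,j$ are joined by an edge of weight $w$ and $0$ otherwise, with diagonal entries making all row sums zero. $\tau=(\tau_1,\ldots,\tau_n)'$ with $\tau_i=2-\delta_i$, $\delta_i$ the degree of vertex $i$; $\hat\tau=\mathrm{diag}(1/\tau_1,\ldots,1/\tau_n)$; $\hat\delta=(\hat\delta_1,\ldots,\hat\delta_n)'$ where $\hat\delta_i$ is the sum of the weights of the edges incident to $i$. A prime denotes transpose. *)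

theory Defs
  imports "HOL-Analysis.Analysis" "Graph_Theory.Graph_Theory"
begin

(* A finite simple undirected graph is a pair_graph: a finite, loop-free digraph whose arc relation
   is symmetric, each edge {u,v} being the two arcs (u,v) and (v,u).  The library predicate "tree"
   does not fit this encoding, because it counts the closed walk u,v,u as a cycle.  In a simple
   graph the cycles in the undirected sense are exactly the directed cycles of length at least 3. *)
definition undirected_tree :: "'a pair_pre_digraph \<Rightarrow> bool" where
  "undirected_tree G \<longleftrightarrow>
     pair_graph G \<and> Digraph_Component.connected (with_proj G) \<and>
     (\<nexists>p. pre_digraph.cycle (with_proj G) p \<and> 3 \<le> length p)"

(* The weight of the edge {u,v} is w (u,v) = w (v,u); values of w off the arcs are irrelevant. *)
definition nonzero_edge_weights :: "'a pair_pre_digraph \<Rightarrow> ('a \<times> 'a \<Rightarrow> real) \<Rightarrow> bool" where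
  "nonzero_edge_weights G w \<longleftrightarrow>
     (\<forall>(u, v) \<in> parcs G. w (u, v) = w (v, u) \<and> w (u, v) \<noteq> 0)"

(* Each undirected edge at v contributes exactly one arc leaving v. *)
definition vdegree :: "'a pair_pre_digraph \<Rightarrow> 'a \<Rightarrow> nat" where
  "vdegree G v = out_degree (with_proj G) v"

definition tree_path :: "'a pair_pre_digraph \<Rightarrow> 'a \<Rightarrow> 'a \<Rightarrow> ('a \<times> 'a) list" where
  "tree_path G i j = (THE p. pre_digraph.apath (with_proj G) i p j)"

definition tree_dist :: "'a pair_pre_digraph \<Rightarrow> ('a \<times> 'a \<Rightarrow> real) \<Rightarrow> 'a \<Rightarrow> 'a \<Rightarrow> real" where
  "tree_dist G w i j = (if i = j then 0 else sum_list (map w (tree_path G i j)))"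

definition sq_dist_matrix :: "'n::finite pair_pre_digraph \<Rightarrow> ('n \<times> 'n \<Rightarrow> real) \<Rightarrow> real^'n^'n" where
  "sq_dist_matrix G w = (\<chi> i j. (tree_dist G w i j)\<^sup>2)"

definition laplacian_offdiag :: "'a pair_pre_digraph \<Rightarrow> ('a \<times> 'a \<Rightarrow> real) \<Rightarrow> 'a \<Rightarrow> 'a \<Rightarrow> real" where
  "laplacian_offdiag G w i j = (if (i, j) \<in> parcs G then - 1 / w (i, j) else 0)"

definition laplacian :: "'n::finite pair_pre_digraph \<Rightarrow> ('n \<times> 'n \<Rightarrow> real) \<Rightarrow> real^'n^'n" where
  "laplacian G w =
     (\<chi> i j. if i = j then - (\<Sum>k\<in>UNIV - {i}. laplacian_offdiag G w i k)
             else laplacian_offdiag G w i j)"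

definition tau :: "'n::finite pair_pre_digraph \<Rightarrow> real^'n" where
  "tau G = (\<chi> i. 2 - real (vdegree G i))"

definition tau_hat :: "'n::finite pair_pre_digraph \<Rightarrow> real^'n^'n" where
  "tau_hat G = (\<chi> i j. if i = j then 1 / tau G $ i else 0)"

definition delta_hat :: "'n::finite pair_pre_digraph \<Rightarrow> ('n \<times> 'n \<Rightarrow> real) \<Rightarrow> real^'n" where
  "delta_hat G w = (\<chi> i. \<Sum>e\<in>out_arcs (with_proj G) i. w e)"

definition beta :: "'n::finite pair_pre_digraph \<Rightarrow> ('n \<times> 'n \<Rightarrow> real) \<Rightarrow> real" where
  "beta G w = delta_hat G w \<bullet> (tau_hat G *v delta_hat G w)"

definition eta :: "'n::finite pair_pre_digraph \<Rightarrow> ('n \<times> 'n \<Rightarrow> real) \<Rightarrow> real^'n" where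
  "eta G w = 2 *\<^sub>R tau G - (laplacian G w ** tau_hat G) *v delta_hat G w"

(* The n-by-n matrix x y' for column vectors x and y. *)
definition outer_product :: "real^'n \<Rightarrow> real^'m \<Rightarrow> real^'m^'n" where
  "outer_product x y = (\<chi> i j. x $ i * y $ j)"

end

(* Let d_j and c_j be the j-th columns of the distance and the squared distance matrix.  In a tree,
   exactly one neighbour p of i <> j lies on the path to j and is closer to j by w(i,p), while every
   other neighbour k is farther by w(i,k).  Hence L d_j = tau - 2 e_j and
   L c_j = 2 diag(tau) d_j - delta, so that L tau_hat L c_j = eta - 4 e_j.  Symmetry of L gives
   tau . c_j = delta . d_j, whence eta . c_j = beta.  Together these say that the claimed inverse
   sends c_j to e_j. *)
theory Submission
  imports Defs
begin

text \<open>\<open>matrix_inv\<close> is a Hilbert choice among two-sided inverses; whichever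
  \<open>C\<close> is chosen, C = C(AB) = (CA)B = B.\<close>

lemma matrix_inv_eqI:
  fixes A :: "'a::semiring_1^'n^'m"
  assumes "A ** B = mat 1" "B ** A = mat 1"
  shows "matrix_inv A = B"
  unfolding matrix_inv_def
proof (rule some_equality)
  fix C assume "A ** C = mat 1 \<and> C ** A = mat 1"
  then have "C = C ** (A ** B)"
    using assms(1) by (simp add: matrix_mul_rid)
  also have "\<dots> = B"
    using \<open>A ** C = mat 1 \<and> C ** A = mat 1\<close> by (simp add: matrix_mul_assoc matrix_mul_lid)
  finally show "C = B" .
qed (use assms in simp)

section \<open>Existence and uniqueness of paths in a tree\<close>

locale weighted_tree = pair_graph G
  for G :: "'n::finite pair_pre_digraph" +
  fixes w :: "'n \<times> 'n \<Rightarrow> real"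
  assumes spanning_verts: "pverts G = UNIV"
    and tree_connected: "Digraph_Component.connected (with_proj G)"
    and no_long_cycle: "cycle p \<Longrightarrow> length p < 3"
    and weight_sym: "(u, v) \<in> parcs G \<Longrightarrow> w (v, u) = w (u, v)"
    and weight_nonzero: "(u, v) \<in> parcs G \<Longrightarrow> w (u, v) \<noteq> 0"
begin

lemma apath_exists: "\<exists>p. apath u p v"
proof -
  have "strongly_connected (with_proj G)"
    using symmetric_connected_imp_strongly_connected pair_sym_arcs tree_connected by blast
  then have "u \<rightarrow>\<^sup>*\<^bsub>with_proj G\<^esub> v"
    by (auto simp: strongly_connected_def spanning_verts)
  then show ?thesis
    by (simp add: reachable_apath)
qed

text \<open>Two paths leaving \<open>u\<close> along different arcs and meeting later close up to a cycle of length
  at least 3.\<close>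
lemma apath_unique:
  assumes "apath u p v" "apath u q v"
  shows "p = q"
  using assms
proof (induction p arbitrary: u q)
  case Nil
  then show ?case
    using apath_ends by blast
next
  case (Cons e p)
  then have "q \<noteq> []"
    using apath_ends by blast
  then obtain f q' where q: "q = f # q'"
    by (cases q) auto
  obtain x where e: "e = (u, x)" "(u, x) \<in> parcs G" "apath x p v" "u \<notin> set (awalk_verts x p)"
    using Cons.prems(1) by (cases e) (auto simp: apath_Cons_iff)
  obtain y where f: "f = (u, y)" "(u, y) \<in> parcs G" "apath y q' v" "u \<notin> set (awalk_verts y q')"
    using Cons.prems(2) q by (cases f) (auto simp: apath_Cons_iff)
  have "x = y"
  proof (rule ccontr)
    assume "x \<noteq> y"
    \<comment> \<open>\<open>r\<close> runs from \<open>x\<close> along \<open>p\<close> to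
      \<open>v\<close> and back along \<open>q'\<close> to \<open>y\<close>; neither half meets
      \<open>u\<close>.\<close>
    define r where "r = p @ rev_path q'"
    have wq: "awalk v (rev_path q') y" and wp: "awalk x p v"
      using e(3) f(3) by (auto simp: apath_def)
    then have wr: "awalk x r y"
      unfolding r_def by (intro awalk_appendI)
    have "set (awalk_verts x r) = set (awalk_verts x p) \<union> set (awalk_verts v (rev_path q'))"
      unfolding r_def using wp wq by (rule set_awalk_verts_append)
    also have "awalk_verts v (rev_path q') = rev (awalk_verts y q')"
      using f(3) by (intro awalk_verts_rev_path) (simp add: apath_def)
    finally have u_r: "u \<notin> set (awalk_verts x r)"
      using e(4) f(4) by simp
    \<comment> \<open>\<open>r\<close> may repeat vertices, which a cycle forbids. Its reduction
      \<open>s\<close> to a simple path uses only arcs of \<open>r\<close>, so it still avoids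
      \<open>u\<close>.\<close>
    define s where "s = awalk_to_apath r"
    have s: "apath x s y" "set s \<subseteq> set r"
      using wr by (simp_all add: s_def apath_awalk_to_apath awalk_to_apath_subset)
    have ws: "awalk x s y"
      using s(1) by (simp add: apath_def)
    have u_s: "u \<notin> set (awalk_verts x s)"
      using u_r s(2) set_awalk_verts[OF ws] set_awalk_verts[OF wr] by auto
    have "s \<noteq> []"
      using \<open>x \<noteq> y\<close> s(1) by (auto simp: apath_Nil_iff)
    have yu: "(y, u) \<in> parcs G"
      using f(2) arcs_symmetric by blast
    have wsu: "awalk x (s @ [(y, u)]) u"
      by (rule awalk_appendI[OF ws]) (use yu in \<open>auto simp: awalk_simps spanning_verts\<close>)
    then have "awalk u ((u, x) # s @ [(y, u)]) u"
      using e(2) by (simp add: awalk_Cons_iff del: awalk_append_iff)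
    moreover have "awalk_verts x (s @ [(y, u)]) = awalk_verts x s @ [u]"
      using awalk_verts_append[OF wsu] by simp
    then have "distinct (tl (awalk_verts u ((u, x) # s @ [(y, u)])))"
      using u_s s(1) by (simp add: apath_def)
    ultimately have "cycle ((u, x) # s @ [(y, u)])"
      unfolding cycle_def by blast
    \<comment> \<open>The arcs \<open>(u, x)\<close> and \<open>(y, u)\<close> and at least one arc
      of \<open>s\<close> give length at least 3.\<close>
    from no_long_cycle[OF this] \<open>s \<noteq> []\<close> show False
      by (cases s) auto
  qed
  with Cons.IH[OF e(3)] e(1) f q show ?case
    by simp
qed

section \<open>Distances in a tree\<close>

lemma tree_path_eqI: "apath i p j \<Longrightarrow> tree_path G i j = p"
  unfolding tree_path_def using apath_unique by blast

text \<open>A simple path with equal ends is empty, so its weight sum 0 agrees with the separate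
  diagonal case of \<open>tree_dist\<close>.\<close>

lemma tree_dist_apath: "apath i p j \<Longrightarrow> tree_dist G w i j = sum_list (map w p)"
  unfolding tree_dist_def using apath_ends[of i p j]
  by (auto simp: tree_path_eqI apath_Nil_iff dest: apath_nonempty_ends)

lemma tree_dist_refl [simp]: "tree_dist G w i i = 0"
  by (simp add: tree_dist_def)

lemma tree_dist_adjacent:
  assumes "(k, j) \<in> parcs G"
  shows "tree_dist G w k j = w (k, j)"
proof -
  have "apath k [(k, j)] j"
    using assms no_loops' by (auto simp: apath_simps spanning_verts)
  from tree_dist_apath[OF this] show ?thesis by simp
qed

text \<open>\<open>p\<close> is the second vertex of the path from \<open>i\<close> to
  \<open>j\<close>. Any other neighbour \<open>k\<close> lies off that path, because the arc
  \<open>(i, k)\<close> is the only path from \<open>i\<close> to \<open>k\<close>; hence prepending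
  \<open>(k, i)\<close> gives the path from \<open>k\<close> to \<open>j\<close>. Weights may be
  negative, so the changes in distance are signed.\<close>

lemma tree_dist_neighbours:
  assumes "i \<noteq> j"
  obtains p where "(i, p) \<in> parcs G" "tree_dist G w p j = tree_dist G w i j - w (i, p)"
    "\<And>k. (i, k) \<in> parcs G \<Longrightarrow> k \<noteq> p \<Longrightarrow> tree_dist G w k j = tree_dist G w i j + w (i, k)"
proof -
  obtain P where P: "apath i P j"
    using apath_exists by blast
  obtain e Q where PeQ: "P = e # Q"
    using P assms by (cases P) (auto simp: apath_Nil_iff)
  obtain p where e: "e = (i, p)" and ip: "(i, p) \<in> parcs G" and Q: "apath p Q j"
    using P PeQ by (cases e) (auto simp: apath_Cons_iff)
  have "tree_dist G w i j = w (i, p) + tree_dist G w p j"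
    using tree_dist_apath[OF P] tree_dist_apath[OF Q] PeQ e by simp
  moreover have "tree_dist G w k j = tree_dist G w i j + w (i, k)"
    if ik: "(i, k) \<in> parcs G" and kp: "k \<noteq> p" for k
  proof -
    have ki: "(k, i) \<in> parcs G"
      using ik arcs_symmetric by blast
    have "k \<notin> set (awalk_verts i P)"
    proof
      assume "k \<in> set (awalk_verts i P)"
      then obtain q r where qr: "awalk i q k" "awalk k r j" "P = q @ r"
        using P awalk_decomp[of i P j k] by (auto simp: apath_def)
      have "awlast i q = k"
        using qr(1) by auto
      with P qr(3) have "apath i q k"
        by (simp add: apath_append_iff)
      moreover have "apath i [(i, k)] k"
        using ik no_loops' by (auto simp: apath_simps spanning_verts)
      \<comment> \<open>Then \<open>P\<close> would begin with \<open>(i, k)\<close>, but its first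
        arc is \<open>(i, p)\<close>.\<close>
      ultimately have "q = [(i, k)]"
        by (rule apath_unique)
      with qr(3) PeQ e kp show False by simp
    qed
    then have "apath k ((k, i) # P) j"
      using ki P by (simp add: apath_Cons_iff)
    from tree_dist_apath[OF this] tree_dist_apath[OF P] weight_sym[OF ik] show ?thesis
      by simp
  qed
  ultimately show ?thesis
    using that[of p] ip by simp
qed

section \<open>The Laplacian as a difference operator\<close>

definition neighbours :: "'n \<Rightarrow> 'n set" where
  "neighbours i = {k. (i, k) \<in> parcs G}"

lemma out_arcs_eq: "out_arcs (with_proj G) i = Pair i ` neighbours i"
  by (auto simp: out_arcs_def neighbours_def)

lemma tau_nth: "tau G $ i = 2 - real (card (neighbours i))"
  by (simp add: tau_def vdegree_def out_degree_def out_arcs_eq card_image inj_on_def)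

lemma delta_hat_nth: "delta_hat G w $ i = (\<Sum>k\<in>neighbours i. w (i, k))"
  by (simp add: delta_hat_def out_arcs_eq sum.reindex inj_on_def)

text \<open>Zero row sums turn the diagonal entry into a subtraction of \<open>x $ i\<close> from
  every \<open>x $ k\<close>, so only differences along edges remain.\<close>

lemma laplacian_mult_nth:
  "(laplacian G w *v x) $ i = (\<Sum>k\<in>neighbours i. (x $ i - x $ k) / w (i, k))"
proof -
  let ?l = "laplacian_offdiag G w i"
  have "(laplacian G w *v x) $ i = (\<Sum>k\<in>UNIV - {i}. ?l k * (x $ k - x $ i))"
    by (simp add: matrix_vector_mult_def laplacian_def sum.remove[of UNIV i] right_diff_distrib
        sum_subtractf sum_distrib_right)
  also have "\<dots> = (\<Sum>k\<in>neighbours i. ?l k * (x $ k - x $ i))"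
    by (rule sum.mono_neutral_right)
      (auto simp: neighbours_def laplacian_offdiag_def dest: no_loops')
  also have "\<dots> = (\<Sum>k\<in>neighbours i. (x $ i - x $ k) / w (i, k))"
    by (rule sum.cong) (auto simp: neighbours_def laplacian_offdiag_def diff_divide_distrib)
  finally show ?thesis .
qed

lemma transpose_laplacian: "transpose (laplacian G w) = laplacian G w"
  by (auto simp: transpose_def laplacian_def laplacian_offdiag_def vec_eq_iff weight_sym
      dest: arcs_symmetric)

lemma inner_laplacian: "(laplacian G w *v x) \<bullet> y = x \<bullet> (laplacian G w *v y)"
  by (metis dot_lmul_matrix transpose_laplacian transpose_matrix_vector)

section \<open>The Laplacian on columns of distances and squared distances\<close>

definition dist_col :: "'n \<Rightarrow> real^'n" where
  "dist_col j = (\<chi> i. tree_dist G w i j)"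

definition sq_dist_col :: "'n \<Rightarrow> real^'n" where
  "sq_dist_col j = (\<chi> i. (tree_dist G w i j)\<^sup>2)"

text \<open>Dividing by the weight leaves a sign per neighbour: 1 for the one towards
  \<open>j\<close> and -1 for the others, in total 2 minus the degree. At \<open>i = j\<close> every
  sign is -1, whence the axis term.\<close>

lemma laplacian_dist_col: "laplacian G w *v dist_col j = tau G - 2 *\<^sub>R axis j 1"
proof (rule vec_eq_iff[THEN iffD2, rule_format])
  fix i
  let ?d = "\<lambda>i. tree_dist G w i j" and ?N = "neighbours i"
  show "(laplacian G w *v dist_col j) $ i = (tau G - 2 *\<^sub>R axis j 1) $ i"
  proof (cases "i = j")
    case True
    have "(\<Sum>k\<in>?N. (?d i - ?d k) / w (i, k)) = (\<Sum>k\<in>?N. - 1)"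
      by (rule sum.cong)
        (auto simp: True neighbours_def tree_dist_adjacent weight_sym weight_nonzero arcs_symmetric)
    then show ?thesis
      using True by (simp add: laplacian_mult_nth dist_col_def tau_nth axis_def)
  next
    case False
    then obtain p where p: "(i, p) \<in> parcs G" "?d p = ?d i - w (i, p)"
      "\<And>k. (i, k) \<in> parcs G \<Longrightarrow> k \<noteq> p \<Longrightarrow> ?d k = ?d i + w (i, k)"
      using tree_dist_neighbours by blast
    \<comment> \<open>The summand is 1 at \<open>p\<close> and -1 elsewhere, written so that the sum
      splits.\<close>
    have "(\<Sum>k\<in>?N. (?d i - ?d k) / w (i, k)) = (\<Sum>k\<in>?N. (if k = p then 2 else 0) - 1)"
      by (rule sum.cong) (auto simp: neighbours_def p weight_nonzero)
    also have "\<dots> = 2 - real (card ?N)"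
      using p(1) by (simp add: sum_subtractf neighbours_def)
    finally show ?thesis
      using False by (simp add: laplacian_mult_nth dist_col_def tau_nth axis_def)
  qed
qed

text \<open>With d the distance from \<open>i\<close> and v the edge weight, a neighbour at distance
  d - v contributes 2d - v and one at d + v contributes -2d - v. At \<open>i = j\<close> the terms
  in d vanish.\<close>

lemma laplacian_sq_dist_col:
  "laplacian G w *v sq_dist_col j = (\<chi> i. 2 * tau G $ i * dist_col j $ i) - delta_hat G w"
proof (rule vec_eq_iff[THEN iffD2, rule_format])
  fix i
  let ?d = "\<lambda>i. tree_dist G w i j" and ?N = "neighbours i"
  have "(\<Sum>k\<in>?N. ((?d i)\<^sup>2 - (?d k)\<^sup>2) / w (i, k))
    = 2 * (2 - real (card ?N)) * ?d i - (\<Sum>k\<in>?N. w (i, k))"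
  proof (cases "i = j")
    case True
    have "(\<Sum>k\<in>?N. ((?d i)\<^sup>2 - (?d k)\<^sup>2) / w (i, k)) = (\<Sum>k\<in>?N. - w (i, k))"
      by (rule sum.cong) (auto simp: True neighbours_def tree_dist_adjacent weight_sym
          weight_nonzero arcs_symmetric power2_eq_square)
    then show ?thesis
      using True by (simp add: sum_negf)
  next
    case False
    then obtain p where p: "(i, p) \<in> parcs G" "?d p = ?d i - w (i, p)"
      "\<And>k. (i, k) \<in> parcs G \<Longrightarrow> k \<noteq> p \<Longrightarrow> ?d k = ?d i + w (i, k)"
      using tree_dist_neighbours by blast
    have "(\<Sum>k\<in>?N. ((?d i)\<^sup>2 - (?d k)\<^sup>2) / w (i, k))
      = (\<Sum>k\<in>?N. (if k = p then 4 * ?d i else 0) - 2 * ?d i - w (i, k))"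
      by (rule sum.cong)
        (auto simp: neighbours_def p weight_nonzero field_simps power2_eq_square)
    also have "\<dots> = 2 * (2 - real (card ?N)) * ?d i - (\<Sum>k\<in>?N. w (i, k))"
      using p(1) by (simp add: sum_subtractf sum.distrib neighbours_def algebra_simps)
    finally show ?thesis .
  qed
  then show "(laplacian G w *v sq_dist_col j) $ i
      = ((\<chi> i. 2 * tau G $ i * dist_col j $ i) - delta_hat G w) $ i"
    by (simp add: laplacian_mult_nth sq_dist_col_def dist_col_def tau_nth delta_hat_nth)
qed

text \<open>Expand \<open>(L d\<^sub>j) \<bullet> c\<^sub>j = d\<^sub>j \<bullet> (L c\<^sub>j)\<close>; the axis term of \<open>L d\<^sub>j\<close> vanishes as \<open>c\<^sub>j\<close> is zero at \<open>j\<close>.\<close>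
lemma tau_sq_dist_col: "tau G \<bullet> sq_dist_col j = delta_hat G w \<bullet> dist_col j"
proof -
  have "tau G \<bullet> sq_dist_col j = (laplacian G w *v dist_col j) \<bullet> sq_dist_col j"
    by (simp add: laplacian_dist_col inner_diff_left inner_axis' sq_dist_col_def)
  also have "\<dots> = dist_col j \<bullet> (laplacian G w *v sq_dist_col j)"
    by (rule inner_laplacian)
  \<comment> \<open>The factor \<open>dist_col j\<close> meets the one in the Laplacian formula, and
    their entrywise product is \<open>sq_dist_col j\<close>.\<close>
  also have "\<dots> = 2 * (tau G \<bullet> sq_dist_col j) - delta_hat G w \<bullet> dist_col j"
    by (simp add: laplacian_sq_dist_col inner_diff_right inner_commute[of _ "delta_hat G w"])
      (simp add: inner_vec_def sq_dist_col_def dist_col_def sum_distrib_left power2_eq_square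
        algebra_simps)
  finally show ?thesis by simp
qed

lemma tau_hat_mult_nth: "(tau_hat G *v x) $ i = x $ i / tau G $ i"
proof -
  have "(tau_hat G *v x) $ i = (\<Sum>k\<in>UNIV. if i = k then x $ i / tau G $ i else 0)"
    unfolding matrix_vector_mult_def tau_hat_def
    by (simp add: if_distrib[of "\<lambda>c. c * _"] cong: if_cong)
  then show ?thesis by simp
qed

section \<open>The inverse matrix when no vertex has degree 2\<close>

context
  assumes no_degree_two: "\<And>v. vdegree G v \<noteq> 2"
begin

text \<open>Excluding degree 2 makes \<open>tau_hat\<close> a genuine inverse of the diagonal matrix
  of \<open>tau\<close>.\<close>

lemma tau_nonzero: "tau G $ i \<noteq> 0"
  using no_degree_two[of i] by (simp add: tau_def)

text \<open>Cancelling \<open>tau\<close> recovers \<open>dist_col j\<close>, on which the Laplacian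
  is already known.\<close>

lemma tau_hat_laplacian_sq_dist_col:
  "tau_hat G *v (laplacian G w *v sq_dist_col j)
    = 2 *\<^sub>R dist_col j - tau_hat G *v delta_hat G w"
  by (simp add: vec_eq_iff tau_hat_mult_nth laplacian_sq_dist_col diff_divide_distrib tau_nonzero)

text \<open>One more Laplacian turns twice \<open>dist_col j\<close> into twice \<open>tau\<close>
  minus 4 times the unit vector; the part independent of \<open>j\<close> is exactly
  \<open>eta\<close>.\<close>

lemma laplacian_tau_hat_laplacian_sq_dist_col:
  "laplacian G w *v (tau_hat G *v (laplacian G w *v sq_dist_col j)) = eta G w - 4 *\<^sub>R axis j 1"
  by (simp add: tau_hat_laplacian_sq_dist_col matrix_vector_mult_diff_distrib laplacian_dist_col
      matrix_vector_mult_scaleR eta_def scaleR_diff_right flip: matrix_vector_mul_assoc)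

text \<open>Moving the Laplacian across the inner product leaves \<open>?y\<close> against its value
  on \<open>sq_dist_col j\<close>. This yields 2 \<open>tau G \<bullet> sq_dist_col j\<close> minus
  \<open>beta\<close>, and the first term cancels against \<open>2 *\<^sub>R tau G\<close> in
  \<open>eta\<close>.\<close>

lemma eta_sq_dist_col: "eta G w \<bullet> sq_dist_col j = beta G w"
proof -
  let ?y = "tau_hat G *v delta_hat G w"
  have "?y \<bullet> (\<chi> i. 2 * tau G $ i * dist_col j $ i) = 2 * (delta_hat G w \<bullet> dist_col j)"
    by (simp add: inner_vec_def tau_hat_mult_nth tau_nonzero sum_distrib_left mult.assoc)
      (simp add: mult.left_commute)
  then have "?y \<bullet> (laplacian G w *v sq_dist_col j) = 2 * (tau G \<bullet> sq_dist_col j) - beta G w"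
    by (simp add: laplacian_sq_dist_col inner_diff_right tau_sq_dist_col beta_def
        inner_commute[of ?y "delta_hat G w"])
  then show ?thesis
    by (simp add: eta_def inner_diff_left inner_laplacian flip: matrix_vector_mul_assoc)
qed

text \<open>On column \<open>j\<close> the Laplacian part gives the unit vector minus a quarter of
  \<open>eta\<close>, and the rank-one part restores that quarter because \<open>beta\<close>
  cancels.\<close>

lemma sq_dist_matrix_left_inverse:
  assumes "beta G w \<noteq> 0"
  shows "(- (1 / 4) *\<^sub>R (laplacian G w ** tau_hat G ** laplacian G w)
      + (1 / (4 * beta G w)) *\<^sub>R outer_product (eta G w) (eta G w)) ** sq_dist_matrix G w = mat 1"
    (is "?B ** _ = _")
proof -
  have outer: "outer_product x y *v z = (y \<bullet> z) *\<^sub>R x" for x y z :: "real^'n"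
    by (simp add: outer_product_def matrix_vector_mult_def vec_eq_iff inner_vec_def
        sum_distrib_left mult_ac)
  have scale: "(c *\<^sub>R A) *v z = c *\<^sub>R (A *v z)" for c and A :: "real^'n^'n" and z
    by (simp add: matrix_vector_mult_def vec_eq_iff sum_distrib_left mult_ac)
  have col: "?B *v sq_dist_col j = axis j 1" for j
    using assms
    by (simp add: matrix_vector_mult_diff_rdistrib scale outer eta_sq_dist_col scaleR_diff_right
        laplacian_tau_hat_laplacian_sq_dist_col flip: matrix_vector_mul_assoc)
  have "(?B ** sq_dist_matrix G w) $ i $ j = (?B *v sq_dist_col j) $ i" for i j
    by (simp add: matrix_matrix_mult_def matrix_vector_mult_def sq_dist_matrix_def sq_dist_col_def)
  then show ?thesis
    by (simp only: col vec_eq_iff) (simp add: mat_def axis_def)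
qed

end

end

theorem theorem4p4:
  fixes G :: "'n::finite pair_pre_digraph"
    and w :: "'n \<times> 'n \<Rightarrow> real"
  assumes "undirected_tree G"
    and "pverts G = UNIV"
    and "nonzero_edge_weights G w"
    and "\<And>v. vdegree G v \<noteq> 2"
    and "beta G w \<noteq> 0"
  shows "invertible (sq_dist_matrix G w) \<and>
         matrix_inv (sq_dist_matrix G w) =
           - (1 / 4) *\<^sub>R (laplacian G w ** tau_hat G ** laplacian G w)
           + (1 / (4 * beta G w)) *\<^sub>R outer_product (eta G w) (eta G w)"
proof -
  interpret pair_graph G
    using assms(1) by (simp add: undirected_tree_def)
  interpret weighted_tree G w
    using assms(1-3) by unfold_locales
      (auto simp: undirected_tree_def nonzero_edge_weights_def not_le[symmetric])
  note left_inv = sq_dist_matrix_left_inverse[OF assms(4,5)]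
  \<comment> \<open>For square matrices over a field a left inverse is also a right inverse, so the
    columnwise computation suffices.\<close>
  then have right_inv: "sq_dist_matrix G w **
      (- (1 / 4) *\<^sub>R (laplacian G w ** tau_hat G ** laplacian G w)
      + (1 / (4 * beta G w)) *\<^sub>R outer_product (eta G w) (eta G w)) = mat 1"
    by (rule matrix_left_right_inverse[THEN iffD1])
  show ?thesis
    using matrix_inv_eqI[OF right_inv left_inv] left_inv right_inv
    unfolding invertible_def by blast
qed

end
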